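(* Consider the basis of $1$-vectors for $Cl(0,6)=M(8,\mathbb{R})$ given by $$\begin{aligned} Y_1&=\sigma_x\otimes(i\sigma_y)\otimes(-\sigma_z), & Y_4&=-\sigma_z\otimes(i\sigma_y)\otimes\sigma_z,\\ Y_2&=(i\sigma_y)\otimes\sigma_x\otimes\sigma_x, & Y_5&=-I_2\otimes(i\sigma_y)\otimes\sigma_x,\\ Y_3&=(i\sigma_y)\otimes I_2\otimes\sigma_z, & Y_6&=-(i\sigma_y)\otimes\sigma_z\otimes\sigma_x . \end{aligned}$$ With respect to this basis of $1$-vectors: (i) reversion on $Cl(0,6)$ is given by $\Phi^{rev}(X)=\widetilde{J}_8^TX^T\widetilde{J}_8$ for all $X\in Cl(0,6)$; (ii) the grade involution on $Cl(0,6)$ is given by $\Phi^{gr}(X)=\widetilde{J}_8^TX\widetilde{J}_8$. Thus the algebra of even vectors in $Cl(0,6)$ is the image of $M(4,\mathbb{C})$ under $\theta_{\mathbb{C}}$ in $M(8,\mathbb{R})$.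
   Context: Pauli matrices: $\sigma_x=\begin{pmatrix}0&1\\1&0\end{pmatrix}$, $\sigma_y=\begin{pmatrix}0&-i\\i&0\end{pmatrix}$, $\sigma_z=\begin{pmatrix}1&0\\0&-1\end{pmatrix}$; $\otimes$ is the Kronecker product. $J_2=\begin{pmatrix}0&1\\-1&0\end{pmatrix}$ and $\widetilde{J}_8=J_2\oplus J_2\oplus J_2\oplus J_2$. $Cl(p,q)$ is the real Clifford algebra generated by $p+q$ pairwise anticommuting generators, $p$ of which square to $+1$ and $q$ to $-1$. To say that a set of matrices in a matrix algebra $\mathcal{A}$ (viewed as a real algebra) is a basis of $1$-vectors for $Cl(p,q)=\mathcal{A}$ means that they satisfy these relations and that $\mathcal{A}$ is thereby identified with $Cl(p,q)$; the space of $1$-vectors is their real span. Reversion $\Phi^{rev}$ (resp. Clifford conjugation $\Phi^{cc}$) is the unique real-linear anti-automorphism fixing $1$ and sending every $1$-vector $v$ to $v$ (resp. $-v$). The grade involution is $\Phi^{gr}=\Phi^{rev}\circ\Phi^{cc}$; an element $X$ is even if $\Phi^{gr}(X)=X$. $\theta_{\mathbb{C}}:M(n,\mathbb{C})\to M(2n,\mathbb{R})$ replaces each entry $x+iy$ ($x,y\in\mathbb{R}$) by the $2\times2$ block $\begin{pmatrix}x&y\\-y&x\end{pmatrix}$. *)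

theory Defs
  imports "HOL-Analysis.Analysis" "HOL-Library.Poly_Mapping"
begin

section \<open>Matrices\<close>

text \<open>
  Matrices over a product index type stand for matrices with lexicographically ordered rows and
  columns: \<open>(a, k)\<close> is row \<open>k\<close> of block row \<open>a\<close>.  With this reading the Kronecker product, the
  direct sum and the blockwise embedding \<open>theta_C\<close> below are literally the usual ones,
  \<open>M(8, \<real>)\<close> is the full type \<open>mat8\<close>, and \<open>M(4, \<complex>)\<close> is the type \<open>cmat4\<close>.
  Multiplication is \<open>**\<close> and the identity is \<open>mat 1\<close>.
\<close>

type_synonym mat8 = "real^((2 \<times> 2) \<times> 2)^((2 \<times> 2) \<times> 2)"
type_synonym cmat4 = "complex^(2 \<times> 2)^(2 \<times> 2)"

definition kron :: "'a::times^'m^'m \<Rightarrow> 'a^'n^'n \<Rightarrow> 'a^('m \<times> 'n)^('m \<times> 'n)"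
    (infixl "\<otimes>\<^sub>K" 75) where
  "A \<otimes>\<^sub>K B = (\<chi> p q. A $ fst p $ fst q * B $ snd p $ snd q)"

definition direct_sum :: "('b::finite \<Rightarrow> 'a::zero^'n^'n) \<Rightarrow> 'a^('b \<times> 'n)^('b \<times> 'n)" where
  "direct_sum A = (\<chi> p q. if fst p = fst q then A (fst p) $ snd p $ snd q else 0)"

definition sigma_x :: "'a::ring_1^2^2" where
  "sigma_x = vector [vector [0, 1], vector [1, 0]]"

definition sigma_y :: "complex^2^2" where
  "sigma_y = vector [vector [0, - \<i>], vector [\<i>, 0]]"

definition sigma_z :: "'a::ring_1^2^2" where
  "sigma_z = vector [vector [1, 0], vector [0, -1]]"

definition i_sigma_y :: "real^2^2" where
  "i_sigma_y = (\<chi> k l. Re (\<i> * sigma_y $ k $ l))"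

text \<open>Nothing is lost by taking real parts: \<open>i \<sigma>\<^sub>y\<close> has real entries.\<close>

lemma i_sigma_y_complex: "complex_of_real (i_sigma_y $ k $ l) = \<i> * sigma_y $ k $ l"
  using exhaust_2[of k] exhaust_2[of l] by (auto simp: i_sigma_y_def sigma_y_def)

definition J2 :: "real^2^2" where
  "J2 = vector [vector [0, 1], vector [-1, 0]]"

text \<open>The index type \<open>2 \<times> 2\<close> enumerates the four summands.\<close>

definition J8_tilde :: mat8 where
  "J8_tilde = direct_sum (\<lambda>_ :: 2 \<times> 2. J2)"

definition theta_block :: "complex \<Rightarrow> real^2^2" where
  "theta_block z = vector [vector [Re z, Im z], vector [- Im z, Re z]]"

definition theta_C :: "complex^'n::finite^'n \<Rightarrow> real^('n \<times> 2)^('n \<times> 2)" where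
  "theta_C A = (\<chi> p q. theta_block (A $ fst p $ fst q) $ snd p $ snd q)"


section \<open>Clifford algebras by generators and relations\<close>

text \<open>
  The free monoid on \<open>'a\<close>, written additively so that \<open>'a list \<Rightarrow>\<^sub>0 real\<close>, with the convolution
  product of \<open>Poly_Mapping\<close>, is the free real algebra on \<open>'a\<close>.
\<close>

instantiation list :: (type) monoid_add
begin

definition "0 = ([] :: 'a list)"
definition "xs + ys = xs @ (ys :: 'a list)"

instance
  by standard (simp_all add: zero_list_def plus_list_def)

end

text \<open>The free real algebra on the \<open>n\<close> generators \<open>0, \<dots>, n - 1\<close>.\<close>

definition free_algebra :: "nat \<Rightarrow> (nat list \<Rightarrow>\<^sub>0 real) set" where
  "free_algebra n = {f. Poly_Mapping.keys f \<subseteq> lists {..<n}}"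

abbreviation gen :: "nat \<Rightarrow> nat list \<Rightarrow>\<^sub>0 real" where
  "gen i \<equiv> Poly_Mapping.single [i] 1"

abbreviation scalar :: "real \<Rightarrow> nat list \<Rightarrow>\<^sub>0 real" where
  "scalar c \<equiv> Poly_Mapping.single [] c"

text \<open>The first \<open>p\<close> generators square to \<open>1\<close>, the remaining ones to \<open>-1\<close>.\<close>

definition gen_square :: "nat \<Rightarrow> nat \<Rightarrow> real" where
  "gen_square p i = (if i < p then 1 else -1)"

text \<open>
  The two-sided ideal of \<open>free_algebra (p + q)\<close> generated by the Clifford relations;
  \<open>Cl(p,q)\<close> is the quotient \<open>free_algebra (p + q) / clifford_ideal p q\<close>.
\<close>

inductive_set clifford_ideal :: "nat \<Rightarrow> nat \<Rightarrow> (nat list \<Rightarrow>\<^sub>0 real) set" for p q :: nat where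
  square: "i < p + q \<Longrightarrow> gen i * gen i - scalar (gen_square p i) \<in> clifford_ideal p q"
| anticommute: "i < p + q \<Longrightarrow> j < p + q \<Longrightarrow> i \<noteq> j \<Longrightarrow>
    gen i * gen j + gen j * gen i \<in> clifford_ideal p q"
| zero: "0 \<in> clifford_ideal p q"
| add: "f \<in> clifford_ideal p q \<Longrightarrow> g \<in> clifford_ideal p q \<Longrightarrow> f + g \<in> clifford_ideal p q"
| left: "f \<in> clifford_ideal p q \<Longrightarrow> g \<in> free_algebra (p + q) \<Longrightarrow> g * f \<in> clifford_ideal p q"
| right: "f \<in> clifford_ideal p q \<Longrightarrow> g \<in> free_algebra (p + q) \<Longrightarrow> f * g \<in> clifford_ideal p q"

definition word_prod :: "(real^'n^'n) list \<Rightarrow> real^'n^'n" where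
  "word_prod Xs = foldr (**) Xs (mat 1)"

text \<open>The algebra homomorphism that sends generator \<open>i\<close> to the matrix \<open>Y ! i\<close>.\<close>

definition free_eval :: "(real^'n^'n) list \<Rightarrow> (nat list \<Rightarrow>\<^sub>0 real) \<Rightarrow> real^'n^'n" where
  "free_eval Y f = (\<Sum>w\<in>Poly_Mapping.keys f. Poly_Mapping.lookup f w *\<^sub>R word_prod (map ((!) Y) w))"

definition clifford_relations :: "nat \<Rightarrow> nat \<Rightarrow> (real^'n^'n) list \<Rightarrow> bool" where
  "clifford_relations p q Y \<longleftrightarrow> length Y = p + q \<and>
     (\<forall>i<p + q. Y ! i ** Y ! i = gen_square p i *\<^sub>R mat 1) \<and>
     (\<forall>i<p + q. \<forall>j<p + q. i \<noteq> j \<longrightarrow> Y ! i ** Y ! j = - (Y ! j ** Y ! i))"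

text \<open>
  The matrices \<open>Y\<close> satisfy the relations of \<open>Cl(p,q)\<close>, and the resulting homomorphism from
  \<open>Cl(p,q)\<close> to the algebra of all real matrices of the given size is an isomorphism: it is
  surjective, and its kernel is trivial in the quotient by \<open>clifford_ideal p q\<close>.
\<close>

definition is_one_vector_basis :: "nat \<Rightarrow> nat \<Rightarrow> (real^'n^'n) list \<Rightarrow> bool" where
  "is_one_vector_basis p q Y \<longleftrightarrow> clifford_relations p q Y \<and>
     free_eval Y ` free_algebra (p + q) = UNIV \<and>
     {f \<in> free_algebra (p + q). free_eval Y f = 0} = clifford_ideal p q"

definition one_vectors :: "(real^'n^'n) list \<Rightarrow> (real^'n^'n) set" where
  "one_vectors Y = span (set Y)"

definition anti_automorphism :: "(real^'n^'n \<Rightarrow> real^'n^'n) \<Rightarrow> bool" where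
  "anti_automorphism \<Phi> \<longleftrightarrow> linear \<Phi> \<and> bij \<Phi> \<and> \<Phi> (mat 1) = mat 1 \<and>
     (\<forall>A B. \<Phi> (A ** B) = \<Phi> B ** \<Phi> A)"

text \<open>
  The descriptions below are proper (the maps exist and are unique) whenever \<open>Y\<close> is a basis of
  1-vectors in the sense of \<open>is_one_vector_basis\<close>.
\<close>

definition reversion :: "(real^'n^'n) list \<Rightarrow> real^'n^'n \<Rightarrow> real^'n^'n" where
  "reversion Y = (THE \<Phi>. anti_automorphism \<Phi> \<and> (\<forall>v\<in>one_vectors Y. \<Phi> v = v))"

definition clifford_conjugation :: "(real^'n^'n) list \<Rightarrow> real^'n^'n \<Rightarrow> real^'n^'n" where
  "clifford_conjugation Y = (THE \<Phi>. anti_automorphism \<Phi> \<and> (\<forall>v\<in>one_vectors Y. \<Phi> v = - v))"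

definition grade_involution :: "(real^'n^'n) list \<Rightarrow> real^'n^'n \<Rightarrow> real^'n^'n" where
  "grade_involution Y = reversion Y \<circ> clifford_conjugation Y"

definition even_vectors :: "(real^'n^'n) list \<Rightarrow> (real^'n^'n) set" where
  "even_vectors Y = {X. grade_involution Y X = X}"


section \<open>The six 1-vectors\<close>

definition Y1 :: mat8 where "Y1 = sigma_x \<otimes>\<^sub>K i_sigma_y \<otimes>\<^sub>K (- sigma_z)"
definition Y2 :: mat8 where "Y2 = i_sigma_y \<otimes>\<^sub>K sigma_x \<otimes>\<^sub>K sigma_x"
definition Y3 :: mat8 where "Y3 = i_sigma_y \<otimes>\<^sub>K mat 1 \<otimes>\<^sub>K sigma_z"
definition Y4 :: mat8 where "Y4 = (- sigma_z) \<otimes>\<^sub>K i_sigma_y \<otimes>\<^sub>K sigma_z"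
definition Y5 :: mat8 where "Y5 = (- mat 1) \<otimes>\<^sub>K i_sigma_y \<otimes>\<^sub>K sigma_x"
definition Y6 :: mat8 where "Y6 = (- i_sigma_y) \<otimes>\<^sub>K sigma_z \<otimes>\<^sub>K sigma_x"

definition Y_basis :: "mat8 list" where
  "Y_basis = [Y1, Y2, Y3, Y4, Y5, Y6]"

end

(*
  Modulo the Clifford relations every word in the generators is a multiple of an increasing one.
  Conjugation by the generators acts on the 2^n increasing monomials by signs which, for n even,
  distinguish them; hence their images under any matrix representation are linearly independent.
  If 2^n is the dimension of the matrix algebra, the representation is therefore an isomorphism.
  An anti-automorphism is determined by its values on the generators, so it remains to check that
  X |-> J^T X^T J fixes the six skew-symmetric matrices Y_i, which also gives
  X |-> X^T as Clifford conjugation. The even elements are the matrices commuting with J.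
*)
theory Submission
  imports Defs
begin

section \<open>Evaluation of noncommutative polynomials at matrices\<close>

lemma matrix_add_rdistrib: "(A + B) ** (C :: 'a::semiring_1^'n^'m) = A ** C + B ** C"
  by (simp add: matrix_matrix_mult_def vec_eq_iff sum.distrib distrib_right)

lemma matrix_mult_sum_left: "(\<Sum>i\<in>A. f i) ** (B :: real^'n^'m) = (\<Sum>i\<in>A. f i ** B)"
  by (induction A rule: infinite_finite_induct) (auto simp: matrix_add_rdistrib)

lemma matrix_mult_sum_right: "(B :: real^'n^'m) ** (\<Sum>i\<in>A. f i) = (\<Sum>i\<in>A. B ** f i)"
  by (induction A rule: infinite_finite_induct) (auto simp: matrix_add_ldistrib)

lemma matrix_mult_minus_left: "(- A) ** (B :: 'a::ring_1^'n^'m) = - (A ** B)"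
  by (simp add: matrix_matrix_mult_def vec_eq_iff sum_negf)

lemma matrix_mult_minus_right: "A ** (- B :: 'a::ring_1^'n^'m) = - (A ** B)"
  by (simp add: matrix_matrix_mult_def vec_eq_iff sum_negf)

lemma matrix_mult_scaleR_left: "(c *\<^sub>R A) ** (B :: real^'n^'m) = c *\<^sub>R (A ** B)"
  by (simp add: matrix_matrix_mult_def vec_eq_iff sum_distrib_left mult.assoc)

lemma matrix_mult_scaleR_right: "A ** (c *\<^sub>R B :: real^'n^'m) = c *\<^sub>R (A ** B)"
  by (simp add: matrix_matrix_mult_def vec_eq_iff sum_distrib_left algebra_simps)

lemma word_prod_Nil [simp]: "word_prod [] = mat 1"
  by (simp add: word_prod_def)

lemma word_prod_Cons [simp]: "word_prod (X # Xs) = X ** word_prod Xs"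
  by (simp add: word_prod_def)

lemma word_prod_append: "word_prod (Xs @ Ys) = word_prod Xs ** word_prod Ys"
  by (induction Xs) (auto simp: matrix_mul_assoc)

text \<open>Words outside the support have coefficient zero. This makes it possible to evaluate
  several polynomials over one common index set.\<close>

lemma free_eval_superset:
  assumes "finite A" "Poly_Mapping.keys f \<subseteq> A"
  shows "free_eval Y f = (\<Sum>w\<in>A. Poly_Mapping.lookup f w *\<^sub>R word_prod (map ((!) Y) w))"
  unfolding free_eval_def using assms
  by (intro sum.mono_neutral_left) (auto simp: in_keys_iff)

lemma free_eval_zero [simp]: "free_eval Y 0 = 0"
  by (simp add: free_eval_def)

lemma free_eval_single [simp]:
  "free_eval Y (Poly_Mapping.single w c) = c *\<^sub>R word_prod (map ((!) Y) w)"
  by (simp add: free_eval_def)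

lemma free_eval_add: "free_eval Y (f + g) = free_eval Y f + free_eval Y g"
proof -
  let ?A = "Poly_Mapping.keys f \<union> Poly_Mapping.keys g"
  have "Poly_Mapping.keys (f + g) \<subseteq> ?A"
    by (rule Poly_Mapping.keys_add)
  then show ?thesis
    by (simp add: free_eval_superset[of ?A] lookup_add scaleR_left_distrib sum.distrib)
qed

lemma free_eval_diff: "free_eval Y (f - g) = free_eval Y f - free_eval Y g"
  using free_eval_add[of Y "f - g" g] by simp

lemma free_eval_sum: "free_eval Y (\<Sum>i\<in>A. f i) = (\<Sum>i\<in>A. free_eval Y (f i))"
  by (induction A rule: infinite_finite_induct) (auto simp: free_eval_add)

lemma poly_mapping_sum_single:
  "f = (\<Sum>w\<in>Poly_Mapping.keys f. Poly_Mapping.single w (Poly_Mapping.lookup f w))"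
  by (rule poly_mapping_eqI)
    (auto simp: lookup_sum lookup_single when_def in_keys_iff sum.delta)

lemma single_mult_list:
  "Poly_Mapping.single u c * Poly_Mapping.single v d = Poly_Mapping.single (u @ v) (c * d)"
  by (simp add: mult_single plus_list_def)

lemma free_eval_mult: "free_eval Y (f * g) = free_eval Y f ** free_eval Y g"
proof -
  have "free_eval Y (f * g) =
      free_eval Y (\<Sum>u\<in>Poly_Mapping.keys f. \<Sum>v\<in>Poly_Mapping.keys g.
        Poly_Mapping.single (u @ v) (Poly_Mapping.lookup f u * Poly_Mapping.lookup g v))"
    by (subst poly_mapping_sum_single[of f], subst poly_mapping_sum_single[of g])
      (simp add: sum_product single_mult_list)
  also have "\<dots> = (\<Sum>u\<in>Poly_Mapping.keys f. \<Sum>v\<in>Poly_Mapping.keys g.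
      (Poly_Mapping.lookup f u *\<^sub>R word_prod (map ((!) Y) u)) **
      (Poly_Mapping.lookup g v *\<^sub>R word_prod (map ((!) Y) v)))"
    by (simp add: free_eval_sum word_prod_append matrix_mult_scaleR_left matrix_mult_scaleR_right
        mult.commute)
  also have "\<dots> = free_eval Y f ** free_eval Y g"
    unfolding free_eval_def matrix_mult_sum_left by (simp add: matrix_mult_sum_right)
  finally show ?thesis .
qed

section \<open>Ordered monomials span the Clifford algebra\<close>

lemma single_in_free_algebra: "w \<in> lists {..<n} \<Longrightarrow> Poly_Mapping.single w c \<in> free_algebra n"
  by (auto simp: free_algebra_def)

lemma free_algebra_add:
  "f \<in> free_algebra n \<Longrightarrow> g \<in> free_algebra n \<Longrightarrow> f + g \<in> free_algebra n"
  using Poly_Mapping.keys_add[of f g] unfolding free_algebra_def by blast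

lemma free_algebra_diff:
  "f \<in> free_algebra n \<Longrightarrow> g \<in> free_algebra n \<Longrightarrow> f - g \<in> free_algebra n"
  using keys_diff[of f g] unfolding free_algebra_def by blast

lemma free_algebra_mult:
  "f \<in> free_algebra n \<Longrightarrow> g \<in> free_algebra n \<Longrightarrow> f * g \<in> free_algebra n"
  using keys_mult[of f g] unfolding free_algebra_def
  by (fastforce simp: plus_list_def)

lemma clifford_ideal_subset_free_algebra: "clifford_ideal p q \<subseteq> free_algebra (p + q)"
proof
  fix f assume "f \<in> clifford_ideal p q"
  then show "f \<in> free_algebra (p + q)"
  proof induction
    case (square i)
    then show ?case
      by (intro free_algebra_diff free_algebra_mult single_in_free_algebra) auto
  next
    case (anticommute i j)
    then show ?case
      by (intro free_algebra_add free_algebra_mult single_in_free_algebra) auto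
  next
    case zero
    then show ?case by (simp add: free_algebra_def)
  qed (auto intro: free_algebra_add free_algebra_mult)
qed

text \<open>Evaluation is additive and multiplicative, so only the generating relations need
  checking. Hence \<open>free_eval Y\<close> factors through the Clifford algebra; this is the easy
  inclusion for the kernel.\<close>

lemma free_eval_clifford_ideal:
  assumes "clifford_relations p q Y" "f \<in> clifford_ideal p q"
  shows "free_eval Y f = 0"
  using assms(2)
proof induction
  case (square i)
  then show ?case
    using assms(1) by (simp add: clifford_relations_def free_eval_diff free_eval_mult)
next
  case (anticommute i j)
  then have "Y ! i ** Y ! j = - (Y ! j ** Y ! i)"
    using assms(1) unfolding clifford_relations_def by blast
  then show ?case
    by (simp add: free_eval_add free_eval_mult)
qed (simp_all add: free_eval_add free_eval_mult)

lemma clifford_ideal_scale: "f \<in> clifford_ideal p q \<Longrightarrow> scalar c * f \<in> clifford_ideal p q"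
  by (rule clifford_ideal.left) (auto intro: single_in_free_algebra)

lemma clifford_ideal_sum:
  "(\<And>i. i \<in> A \<Longrightarrow> f i \<in> clifford_ideal p q) \<Longrightarrow> (\<Sum>i\<in>A. f i) \<in> clifford_ideal p q"
  by (induction A rule: infinite_finite_induct)
    (auto intro: clifford_ideal.zero clifford_ideal.add)

text \<open>The insertion step of an insertion sort modulo the relations: passing a smaller letter
  costs a sign, and meeting an equal letter contracts the pair to a scalar. The bound on
  \<open>set ys\<close> keeps the result increasing when a smaller letter is put back in
  front.\<close>

lemma clifford_reduce_Cons:
  assumes "sorted_wrt (<) xs" "set xs \<subseteq> {..<p + q}" "i < p + q"
  shows "\<exists>c ys. sorted_wrt (<) ys \<and> set ys \<subseteq> insert i (set xs) \<and>
    Poly_Mapping.single (i # xs) 1 - Poly_Mapping.single ys c \<in> clifford_ideal p q"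
  using assms
proof (induction xs)
  case Nil
  then show ?case
    by (intro exI[of _ 1] exI[of _ "[i]"]) (auto intro: clifford_ideal.zero)
next
  case (Cons x xs)
  have tail: "Poly_Mapping.single xs 1 \<in> free_algebra (p + q)"
    using Cons.prems by (intro single_in_free_algebra) auto
  consider "i < x" | "i = x" | "x < i" by linarith
  then show ?case
  proof cases
    case 1
    then have "sorted_wrt (<) (i # x # xs)"
      using Cons.prems by auto
    then show ?thesis
      by (intro exI[of _ 1] exI[of _ "i # x # xs"]) (auto intro: clifford_ideal.zero)
  next
    case 2
    have "(gen i * gen i - scalar (gen_square p i)) * Poly_Mapping.single xs 1
        \<in> clifford_ideal p q"
      using Cons.prems tail by (intro clifford_ideal.right clifford_ideal.square)
    moreover have "(gen i * gen i - scalar (gen_square p i)) * Poly_Mapping.single xs 1 =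
        Poly_Mapping.single (i # x # xs) 1 - Poly_Mapping.single xs (gen_square p i)"
      using 2 by (simp add: single_mult_list left_diff_distrib)
    ultimately show ?thesis
      using Cons.prems by (intro exI[of _ "gen_square p i"] exI[of _ xs]) auto
  next
    case 3
    obtain c ys where ys: "sorted_wrt (<) ys" "set ys \<subseteq> insert i (set xs)"
      "Poly_Mapping.single (i # xs) 1 - Poly_Mapping.single ys c \<in> clifford_ideal p q"
      using Cons by auto
    have "(gen i * gen x + gen x * gen i) * Poly_Mapping.single xs 1 \<in> clifford_ideal p q"
      using Cons.prems tail 3 by (intro clifford_ideal.right clifford_ideal.anticommute) auto
    moreover have "Poly_Mapping.single [x] (-1) *
        (Poly_Mapping.single (i # xs) 1 - Poly_Mapping.single ys c) \<in> clifford_ideal p q"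
      using Cons.prems by (intro clifford_ideal.left ys single_in_free_algebra) auto
    ultimately have "(gen i * gen x + gen x * gen i) * Poly_Mapping.single xs 1 +
        Poly_Mapping.single [x] (-1) *
        (Poly_Mapping.single (i # xs) 1 - Poly_Mapping.single ys c) \<in> clifford_ideal p q"
      by (rule clifford_ideal.add)
    \<comment> \<open>The two copies of the word \<open>x # i # xs\<close> cancel: anticommuting
      \<open>i\<close> past \<open>x\<close> produces the sign in \<open>- c\<close>, and the
      inductive reduction is applied behind \<open>x\<close>.\<close>
    also have "(gen i * gen x + gen x * gen i) * Poly_Mapping.single xs 1 +
        Poly_Mapping.single [x] (-1) *
        (Poly_Mapping.single (i # xs) 1 - Poly_Mapping.single ys c) =
        Poly_Mapping.single (i # x # xs) 1 - Poly_Mapping.single (x # ys) (- c)"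
      by (simp add: single_mult_list distrib_right right_diff_distrib single_uminus)
    finally show ?thesis
      using ys(1,2) Cons.prems 3 by (intro exI[of _ "- c"] exI[of _ "x # ys"]) auto
  qed
qed

text \<open>Strictly increasing words encode the subsets of the generators, that is, the standard
  monomial basis of the Clifford algebra.\<close>

definition ordered_words :: "nat \<Rightarrow> nat list set" where
  "ordered_words n = {w. sorted_wrt (<) w \<and> set w \<subseteq> {..<n}}"

lemma bij_betw_ordered_words: "bij_betw set (ordered_words n) (Pow {..<n})"
proof (rule bij_betwI[where g = sorted_list_of_set])
  show "sorted_list_of_set \<in> Pow {..<n} \<rightarrow> ordered_words n"
  proof
    fix S assume "S \<in> Pow {..<n}"
    moreover from this have "finite S"
      by (auto intro: finite_subset)
    ultimately show "sorted_list_of_set S \<in> ordered_words n"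
      by (auto simp: ordered_words_def)
  qed
next
  fix S assume "S \<in> Pow {..<n}"
  then have "finite S"
    by (auto intro: finite_subset)
  then show "set (sorted_list_of_set S) = S"
    by simp
qed (auto simp: ordered_words_def strict_sorted_iff sorted_list_of_set.idem_if_sorted_distinct)

lemma finite_ordered_words: "finite (ordered_words n)"
  using bij_betw_finite[OF bij_betw_ordered_words] by simp

lemma card_ordered_words: "card (ordered_words n) = 2 ^ n"
  using bij_betw_same_card[OF bij_betw_ordered_words] by (simp add: card_Pow)

lemma clifford_reduce_word:
  assumes "w \<in> lists {..<p + q}"
  shows "\<exists>c. \<exists>ys \<in> ordered_words (p + q).
    Poly_Mapping.single w 1 - Poly_Mapping.single ys c \<in> clifford_ideal p q"
  using assms
proof (induction w)
  case Nil
  then show ?case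
    by (intro exI[of _ 1] bexI[of _ "[]"]) (auto simp: ordered_words_def intro: clifford_ideal.zero)
next
  case (Cons i w)
  obtain c ys where ys: "ys \<in> ordered_words (p + q)"
    "Poly_Mapping.single w 1 - Poly_Mapping.single ys c \<in> clifford_ideal p q"
    using Cons.IH by blast
  obtain d zs where zs: "sorted_wrt (<) zs" "set zs \<subseteq> insert i (set ys)"
    "Poly_Mapping.single (i # ys) 1 - Poly_Mapping.single zs d \<in> clifford_ideal p q"
    using clifford_reduce_Cons[of ys p q i] Cons.hyps ys(1) by (auto simp: ordered_words_def)
  \<comment> \<open>The tail is reduced first and \<open>i\<close> is then inserted, so the two
    coefficients multiply and the middle term \<open>i # ys\<close> cancels.\<close>
  have "gen i * (Poly_Mapping.single w 1 - Poly_Mapping.single ys c) +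
      scalar c * (Poly_Mapping.single (i # ys) 1 - Poly_Mapping.single zs d)
      \<in> clifford_ideal p q"
    using Cons.hyps ys zs
    by (intro clifford_ideal.add clifford_ideal_scale clifford_ideal.left single_in_free_algebra)
      auto
  also have "gen i * (Poly_Mapping.single w 1 - Poly_Mapping.single ys c) +
      scalar c * (Poly_Mapping.single (i # ys) 1 - Poly_Mapping.single zs d) =
      Poly_Mapping.single (i # w) 1 - Poly_Mapping.single zs (c * d)"
    by (simp add: single_mult_list right_diff_distrib)
  finally show ?case
    using zs(1,2) ys(1) Cons.hyps
    by (intro exI[of _ "c * d"] bexI[of _ zs]) (auto simp: ordered_words_def)
qed

text \<open>Linear extension of the reduction of words: the ordered monomials span the quotient by
  \<open>clifford_ideal p q\<close>.\<close>

lemma clifford_reduce: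
  assumes "f \<in> free_algebra (p + q)"
  obtains g where "Poly_Mapping.keys g \<subseteq> ordered_words (p + q)" "f - g \<in> clifford_ideal p q"
proof -
  let ?K = "Poly_Mapping.keys f"
  have "\<forall>w\<in>?K. \<exists>c ys. ys \<in> ordered_words (p + q) \<and>
      Poly_Mapping.single w 1 - Poly_Mapping.single ys c \<in> clifford_ideal p q"
    using assms clifford_reduce_word unfolding free_algebra_def by blast
  then obtain c ys where cys: "\<And>w. w \<in> ?K \<Longrightarrow> ys w \<in> ordered_words (p + q)"
    "\<And>w. w \<in> ?K \<Longrightarrow> Poly_Mapping.single w 1 - Poly_Mapping.single (ys w) (c w)
      \<in> clifford_ideal p q"
    by metis
  define g where "g = (\<Sum>w\<in>?K. Poly_Mapping.single (ys w) (Poly_Mapping.lookup f w * c w))"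
  have "Poly_Mapping.keys g \<subseteq> ordered_words (p + q)"
    unfolding g_def using cys(1) by (intro order.trans[OF keys_sum]) (auto split: if_splits)
  moreover have "f - g = (\<Sum>w\<in>?K. scalar (Poly_Mapping.lookup f w) *
      (Poly_Mapping.single w 1 - Poly_Mapping.single (ys w) (c w)))"
    unfolding g_def
    by (subst poly_mapping_sum_single[of f])
      (simp add: single_mult_list right_diff_distrib sum_subtractf)
  then have "f - g \<in> clifford_ideal p q"
    by (auto intro!: clifford_ideal_sum clifford_ideal_scale cys)
  ultimately show ?thesis
    using that by blast
qed

section \<open>Ordered monomials are linearly independent\<close>

text \<open>Each letter other than \<open>i\<close> contributes one sign. As \<open>Y ! i\<close> is
  invertible, every monomial is thus an eigenvector of conjugation by \<open>Y ! i\<close>; the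
  commutation form avoids writing inverses.\<close>

lemma clifford_conjugate_word:
  assumes "clifford_relations p q Y" "i < p + q" "w \<in> lists {..<p + q}"
  shows "Y ! i ** word_prod (map ((!) Y) w) =
    (-1) ^ length (filter (\<lambda>j. j \<noteq> i) w) *\<^sub>R (word_prod (map ((!) Y) w) ** Y ! i)"
  using assms(3)
proof (induction w)
  case Nil
  then show ?case by simp
next
  case (Cons j w)
  have "j < p + q"
    using Cons.hyps by simp
  then have "Y ! i ** Y ! j = - (Y ! j ** Y ! i)" if "j \<noteq> i"
    using assms that unfolding clifford_relations_def by metis
  then have "Y ! i ** Y ! j = (if j = i then 1 else -1) *\<^sub>R (Y ! j ** Y ! i)"
    by (cases "j = i") auto
  then have "Y ! i ** (Y ! j ** word_prod (map ((!) Y) w)) =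
      (if j = i then 1 else -1) *\<^sub>R (Y ! j ** (Y ! i ** word_prod (map ((!) Y) w)))"
    by (simp add: matrix_mul_assoc matrix_mult_scaleR_left matrix_mult_minus_left)
  also have "\<dots> = (if j = i then 1 else -1) *\<^sub>R (-1) ^ length (filter (\<lambda>j. j \<noteq> i) w) *\<^sub>R
      (Y ! j ** (word_prod (map ((!) Y) w) ** Y ! i))"
    by (simp only: Cons.IH matrix_mult_scaleR_right)
  finally show ?case
    by (simp add: matrix_mul_assoc)
qed

lemma clifford_word_nonzero:
  fixes Y :: "(real^'n^'n) list"
  assumes "clifford_relations p q Y" "w \<in> lists {..<p + q}"
  shows "word_prod (map ((!) Y) w) \<noteq> 0"
proof -
  have "\<exists>B. B ** word_prod (map ((!) Y) w) = mat 1"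
    using assms(2)
  proof (induction w)
    case Nil
    then show ?case by (auto intro: exI[of _ "mat 1"])
  next
    case (Cons i w)
    then obtain B where B: "B ** word_prod (map ((!) Y) w) = mat 1"
      by blast
    let ?c = "gen_square p i"
    \<comment> \<open>The scalar \<open>?c\<close> is 1 or -1, so \<open>?c\<close> times
      \<open>Y ! i\<close> is the inverse of \<open>Y ! i\<close>; left inverses are accumulated
      letter by letter.\<close>
    have "?c *\<^sub>R (Y ! i ** Y ! i) = mat 1"
      using assms(1) Cons.hyps by (simp add: clifford_relations_def gen_square_def)
    then have "?c *\<^sub>R (B ** Y ! i) ** (Y ! i ** word_prod (map ((!) Y) w)) = mat 1"
      by (metis B matrix_mul_assoc matrix_mul_rid matrix_mult_scaleR_left
          matrix_mult_scaleR_right)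
    then show ?case
      by auto
  qed
  moreover have "mat 1 \<noteq> (0 :: real^'n^'n)"
    by (auto simp: vec_eq_iff mat_def)
  ultimately show ?thesis
    by (metis times0_right)
qed

text \<open>
  The signs by which the generators commute past an ordered monomial tell the monomial apart only
  for even \<open>n\<close>: complementary sets have equal signs when \<open>n\<close> is odd.
\<close>

lemma ordered_words_separated:
  assumes "even n" "u \<in> ordered_words n" "v \<in> ordered_words n" "u \<noteq> v"
  obtains i where "i < n"
    "(-1 :: real) ^ length (filter (\<lambda>j. j \<noteq> i) u) \<noteq> (-1) ^ length (filter (\<lambda>j. j \<noteq> i) v)"
proof -
  have len: "length (filter (\<lambda>j. j \<noteq> i) w) = card (set w - {i})" if "w \<in> ordered_words n" for w i
  proof -
    have "distinct w"
      using that by (auto simp: ordered_words_def strict_sorted_iff)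
    then have "length (filter (\<lambda>j. j \<noteq> i) w) = card (set (filter (\<lambda>j. j \<noteq> i) w))"
      by (metis distinct_card distinct_filter)
    also have "set (filter (\<lambda>j. j \<noteq> i) w) = set w - {i}"
      by auto
    finally show ?thesis .
  qed
  \<comment> \<open>Deleting \<open>i\<close> flips the parity exactly when \<open>i\<close> belongs
    to the set, so the signs record membership up to one global parity.\<close>
  have parity: "even (card (S - {i})) \<longleftrightarrow> (even (card S) \<longleftrightarrow> i \<notin> S)"
    if "finite S" for S :: "nat set" and i
    using that by (cases "i \<in> S") (metis card_Suc_Diff1 even_Suc, simp)
  have ne: "set u \<noteq> set v"
    using assms bij_betw_ordered_words[of n] by (auto simp: bij_betw_def dest: inj_onD)
  have sub: "set u \<subseteq> {..<n}" "set v \<subseteq> {..<n}"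
    using assms by (auto simp: ordered_words_def)
  have "\<exists>i<n. even (card (set u - {i})) \<noteq> even (card (set v - {i}))"
  proof (rule ccontr)
    assume "\<not> ?thesis"
    then have eq: "(even (card (set u)) \<longleftrightarrow> i \<notin> set u) \<longleftrightarrow> (even (card (set v)) \<longleftrightarrow> i \<notin> set v)"
      if "i < n" for i
      using that by (auto simp: parity)
    show False
    proof (cases "even (card (set u)) \<longleftrightarrow> even (card (set v))")
      case True
      then have "i \<in> set u \<longleftrightarrow> i \<in> set v" if "i < n" for i
        using eq[OF that] by blast
      then show False
        using ne sub by blast
    next
      case False
      \<comment> \<open>Different global parities force complementary sets. Their cardinalities add
        up to the even number \<open>n\<close>, so the parities agree after all.\<close>
      then have "i \<in> set u \<longleftrightarrow> i \<notin> set v" if "i < n" for i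
        using eq[OF that] by blast
      then have "set v = {..<n} - set u"
        using sub by blast
      then have "card (set v) = n - card (set u)"
        using sub by (simp add: card_Diff_subset)
      moreover have "card (set u) \<le> n"
        using card_mono[OF _ sub(1)] by simp
      ultimately show False
        using False \<open>even n\<close> by auto
    qed
  qed
  then obtain i where "i < n" "even (card (set u - {i})) \<noteq> even (card (set v - {i}))"
    by blast
  then show ?thesis
    using assms by (intro that[of i]) (auto simp: len minus_one_power_iff)
qed

text \<open>
  Common eigenvectors of the conjugations by the generators, with pairwise distinct systems of
  eigenvalues, are independent.
\<close>

lemma ordered_words_independent:
  assumes Y: "clifford_relations p q Y" and "even (p + q)"
    and "finite W" "W \<subseteq> ordered_words (p + q)"
    and "(\<Sum>w\<in>W. c w *\<^sub>R word_prod (map ((!) Y) w)) = 0"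
  shows "\<forall>w\<in>W. c w = 0"
  using assms(3-5)
\<comment> \<open>The coefficients are generalised because the induction hypothesis is applied to
  rescaled ones.\<close>
proof (induction W arbitrary: c rule: finite_induct)
  case empty
  then show ?case by simp
next
  case (insert v W)
  define M where "M w = word_prod (map ((!) Y) w)" for w
  define s where "s i w = (-1 :: real) ^ length (filter (\<lambda>j. j \<noteq> i) w)" for i and w :: "nat list"
  have lists: "w \<in> lists {..<p + q}" if "w \<in> insert v W" for w
    using that insert.prems(1) by (auto simp: ordered_words_def)
  have conj: "Y ! i ** M w = s i w *\<^sub>R (M w ** Y ! i)" if "i < p + q" "w \<in> insert v W" for i w
    unfolding M_def s_def using that lists Y by (intro clifford_conjugate_word)
  have zero: "c v *\<^sub>R M v + (\<Sum>w\<in>W. c w *\<^sub>R M w) = 0"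
    using insert.prems(2) insert.hyps by (simp add: M_def)
  have W0: "c w = 0" if "w \<in> W" for w
  proof -
    have vw: "v \<in> ordered_words (p + q)" "w \<in> ordered_words (p + q)" "v \<noteq> w"
      using that insert.prems(1) insert.hyps by auto
    obtain i where i: "i < p + q" "s i v \<noteq> s i w"
      unfolding s_def using ordered_words_separated[OF assms(2) vw] .
    have sq: "Y ! i ** Y ! i = gen_square p i *\<^sub>R mat 1"
      using Y i(1) by (simp add: clifford_relations_def)
    \<comment> \<open>Multiplying the relation by \<open>Y ! i\<close> on the left and subtracting
      \<open>s i v\<close> times its right multiple kills the term of \<open>v\<close>, while the
      coefficient of the chosen \<open>w\<close> is only scaled by a nonzero number.\<close>
    have "(\<Sum>w\<in>insert v W. ((s i w - s i v) * c w) *\<^sub>R (M w ** Y ! i)) =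
        Y ! i ** (\<Sum>w\<in>insert v W. c w *\<^sub>R M w) -
        s i v *\<^sub>R ((\<Sum>w\<in>insert v W. c w *\<^sub>R M w) ** Y ! i)"
      unfolding matrix_mult_sum_left matrix_mult_sum_right scaleR_sum_right sum_subtractf[symmetric]
      by (intro sum.cong refl)
        (simp add: matrix_mult_scaleR_left matrix_mult_scaleR_right conj[OF i(1)] algebra_simps)
    also have "\<dots> = 0"
      using insert.prems(2) by (simp add: M_def)
    finally have "(\<Sum>w\<in>W. ((s i w - s i v) * c w) *\<^sub>R (M w ** Y ! i)) = 0"
      using insert.hyps by simp
    \<comment> \<open>A second factor \<open>Y ! i\<close> turns the trailing one into a nonzero
      scalar, which can be cancelled.\<close>
    then have "(\<Sum>w\<in>W. ((s i w - s i v) * c w) *\<^sub>R (M w ** Y ! i)) ** Y ! i = 0"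
      by simp
    then have "gen_square p i *\<^sub>R (\<Sum>w\<in>W. ((s i w - s i v) * c w) *\<^sub>R M w) = 0"
      by (simp add: matrix_mult_sum_left matrix_mult_scaleR_left matrix_mult_scaleR_right
          matrix_mul_assoc[symmetric] sq scaleR_sum_right mult.commute)
    then have "(\<Sum>w\<in>W. ((s i w - s i v) * c w) *\<^sub>R M w) = 0"
      by (simp add: gen_square_def split: if_splits)
    then have "(s i w - s i v) * c w = 0"
      using insert.IH[of "\<lambda>w. (s i w - s i v) * c w"] insert.prems(1) that by (auto simp: M_def)
    then show ?thesis
      using i(2) by simp
  qed
  then have "c v *\<^sub>R M v = 0"
    using zero by simp
  then have "c v = 0"
    using clifford_word_nonzero[OF Y lists[of v]] by (simp add: M_def)
  with W0 show ?case by simp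
qed

text \<open>A dimension count replaces any explicit inverse: the ordered monomials are independent
  and as numerous as the dimension of the matrix algebra, so they form a basis. Spanning gives
  surjectivity; independence gives the kernel.\<close>

theorem is_one_vector_basis_if_relations:
  fixes Y :: "(real^'n^'n) list"
  assumes Y: "clifford_relations p q Y" and even: "even (p + q)"
    and dim: "CARD('n) ^ 2 = 2 ^ (p + q)"
  shows "is_one_vector_basis p q Y"
proof -
  let ?W = "ordered_words (p + q)" and ?F = "free_algebra (p + q)"
  define M where "M w = word_prod (map ((!) Y) w)" for w
  have indep: "\<forall>w\<in>?W. c w = 0" if "(\<Sum>w\<in>?W. c w *\<^sub>R M w) = 0" for c
    using ordered_words_independent[OF Y even finite_ordered_words order.refl] that
    unfolding M_def by blast
  \<comment> \<open>The predicate \<open>independent\<close> concerns the set of images, so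
    coinciding monomials must be excluded before counting. A coincidence would give a relation with
    coefficients 1 and -1.\<close>
  have inj: "inj_on M ?W"
  proof (rule inj_onI, rule ccontr)
    fix u v assume uv: "u \<in> ?W" "v \<in> ?W" "M u = M v" "u \<noteq> v"
    have "(\<Sum>w\<in>?W. (if w = u then 1 else if w = v then -1 else 0) *\<^sub>R M w) =
        (\<Sum>w\<in>{u, v}. (if w = u then 1 else if w = v then -1 else 0) *\<^sub>R M w)"
      using uv by (intro sum.mono_neutral_right finite_ordered_words) auto
    also have "\<dots> = 0"
      using uv by simp
    finally show False
      using indep[of "\<lambda>w. if w = u then 1 else if w = v then -1 else 0"] uv(1) by auto
  qed
  have "independent (M ` ?W)"
  proof (subst independent_explicit_finite_subsets, intro allI impI ballI)
    fix A c x
    assume A: "A \<subseteq> M ` ?W" "finite A" "(\<Sum>x\<in>A. c x *\<^sub>R x) = 0" "x \<in> A"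
    obtain V where V: "V \<subseteq> ?W" "A = M ` V"
      using A(1) by (auto simp: subset_image_iff)
    have "(\<Sum>w\<in>V. c (M w) *\<^sub>R M w) = 0"
      using A(3) V inj by (simp add: sum.reindex inj_on_subset)
    then have "\<forall>w\<in>V. c (M w) = 0"
      using ordered_words_independent[OF Y even finite_subset[OF V(1) finite_ordered_words] V(1),
          of "\<lambda>w. c (M w)"]
      unfolding M_def by simp
    then show "c x = 0"
      using A(4) V(2) by auto
  qed
  moreover have "card (M ` ?W) = DIM(real^'n^'n)"
    using dim by (simp add: card_image[OF inj] card_ordered_words power2_eq_square)
  ultimately have span: "span (M ` ?W) = UNIV"
    using card_ge_dim_independent[of "M ` ?W" UNIV] by (auto simp: dim_UNIV)
  have surj: "X \<in> free_eval Y ` ?F" for X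
  proof -
    have "X \<in> range (\<lambda>c. \<Sum>x\<in>M ` ?W. c x *\<^sub>R x)"
      using span by (simp add: span_finite finite_ordered_words)
    then obtain c where "X = (\<Sum>x\<in>M ` ?W. c x *\<^sub>R x)"
      by blast
    then have "X = (\<Sum>w\<in>?W. c (M w) *\<^sub>R M w)"
      using inj by (simp add: sum.reindex)
    also have "\<dots> = free_eval Y (\<Sum>w\<in>?W. Poly_Mapping.single w (c (M w)))"
      by (simp add: free_eval_sum M_def)
    finally have X: "X = \<dots>" .
    have "Poly_Mapping.keys (\<Sum>w\<in>?W. Poly_Mapping.single w (c (M w))) \<subseteq> lists {..<p + q}"
      by (intro order.trans[OF keys_sum]) (auto simp: ordered_words_def split: if_splits)
    with X show ?thesis
      by (auto simp: free_algebra_def)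
  qed
  have kernel: "f \<in> clifford_ideal p q" if f: "f \<in> ?F" "free_eval Y f = 0" for f
  proof -
    \<comment> \<open>Modulo the ideal, \<open>f\<close> is a combination of ordered monomials that
      still evaluates to zero; independence then makes \<open>g\<close> vanish.\<close>
    obtain g where g: "Poly_Mapping.keys g \<subseteq> ?W" "f - g \<in> clifford_ideal p q"
      using clifford_reduce[OF f(1)] by blast
    have "free_eval Y g = 0"
      using free_eval_clifford_ideal[OF Y g(2)] f(2) by (simp add: free_eval_diff)
    then have "\<forall>w\<in>?W. Poly_Mapping.lookup g w = 0"
      using g(1) by (intro indep) (simp add: free_eval_superset[OF finite_ordered_words] M_def)
    then have "Poly_Mapping.keys g = {}"
      using g(1) by (metis equals0I in_keys_iff subsetD)
    then show ?thesis
      using g(2) by simp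
  qed
  have "free_eval Y ` ?F = UNIV"
    using surj by (intro equalityI subset_UNIV subsetI)
  moreover have "{f \<in> ?F. free_eval Y f = 0} = clifford_ideal p q"
    using kernel clifford_ideal_subset_free_algebra[of p q] free_eval_clifford_ideal[OF Y] by auto
  ultimately show ?thesis
    using Y by (simp add: is_one_vector_basis_def)
qed

section \<open>Anti-automorphisms\<close>

text \<open>By surjectivity of \<open>free_eval\<close>, every matrix is a linear combination of
  words in \<open>Y\<close>, and on a word both maps give the reversed product of the same
  images.\<close>

lemma anti_automorphism_unique:
  assumes basis: "is_one_vector_basis p q Y"
    and \<Phi>: "anti_automorphism \<Phi>" and \<Psi>: "anti_automorphism \<Psi>"
    and eq: "\<And>X. X \<in> set Y \<Longrightarrow> \<Phi> X = \<Psi> X"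
  shows "\<Phi> = \<Psi>"
proof
  fix X
  have len: "length Y = p + q"
    using basis by (simp add: is_one_vector_basis_def clifford_relations_def)
  obtain f where f: "f \<in> free_algebra (p + q)" "X = free_eval Y f"
    using basis by (auto simp: is_one_vector_basis_def)
  have word: "\<Phi> (word_prod (map ((!) Y) w)) = \<Psi> (word_prod (map ((!) Y) w))"
    if "w \<in> lists {..<p + q}" for w
    using that \<Phi> \<Psi> eq len by (induction w) (auto simp: anti_automorphism_def)
  have "linear \<Phi>" "linear \<Psi>"
    using \<Phi> \<Psi> by (auto simp: anti_automorphism_def)
  moreover have "\<forall>w\<in>Poly_Mapping.keys f.
      \<Phi> (word_prod (map ((!) Y) w)) = \<Psi> (word_prod (map ((!) Y) w))"
    using word f(1) by (auto simp: free_algebra_def)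
  ultimately show "\<Phi> X = \<Psi> X"
    unfolding f(2) free_eval_def by (simp add: linear_sum linear_scale)
qed

text \<open>Used with \<open>c\<close> equal to 1 for reversion and to -1 for Clifford
  conjugation.\<close>

lemma one_vectors_eqI:
  assumes "linear \<Phi>" "\<And>X. X \<in> set Y \<Longrightarrow> \<Phi> X = c *\<^sub>R X" "v \<in> one_vectors Y"
  shows "\<Phi> v = c *\<^sub>R v"
  using assms(3) unfolding one_vectors_def
  by (rule linear_eq_on[OF assms(1) linear_scale_self]) (rule assms(2))

text \<open>The candidate itself supplies existence for the definite description, so checking it on
  the generators suffices.\<close>

lemma reversion_eqI:
  assumes "is_one_vector_basis p q Y" "anti_automorphism \<Phi>" "\<And>X. X \<in> set Y \<Longrightarrow> \<Phi> X = X"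
  shows "reversion Y = \<Phi>"
  unfolding reversion_def
proof (rule the_equality)
  show "anti_automorphism \<Phi> \<and> (\<forall>v\<in>one_vectors Y. \<Phi> v = v)"
    using assms one_vectors_eqI[of \<Phi> Y 1] by (auto simp: anti_automorphism_def)
  show "\<Psi> = \<Phi>" if "anti_automorphism \<Psi> \<and> (\<forall>v\<in>one_vectors Y. \<Psi> v = v)" for \<Psi>
    using that assms by (intro anti_automorphism_unique[OF assms(1)])
      (auto simp: one_vectors_def span_base)
qed

lemma clifford_conjugation_eqI:
  assumes "is_one_vector_basis p q Y" "anti_automorphism \<Phi>" "\<And>X. X \<in> set Y \<Longrightarrow> \<Phi> X = - X"
  shows "clifford_conjugation Y = \<Phi>"
  unfolding clifford_conjugation_def
proof (rule the_equality)
  show "anti_automorphism \<Phi> \<and> (\<forall>v\<in>one_vectors Y. \<Phi> v = - v)"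
    using assms one_vectors_eqI[of \<Phi> Y "-1"] by (auto simp: anti_automorphism_def)
  show "\<Psi> = \<Phi>" if "anti_automorphism \<Psi> \<and> (\<forall>v\<in>one_vectors Y. \<Psi> v = - v)" for \<Psi>
    using that assms by (intro anti_automorphism_unique[OF assms(1)])
      (auto simp: one_vectors_def span_base)
qed

text \<open>This is transposition followed by conjugation with an orthogonal matrix. It covers both
  reversion and, with \<open>J\<close> the identity, plain transposition.\<close>

lemma anti_automorphism_twisted_transpose:
  fixes J :: "real^'n^'n"
  assumes "transpose J ** J = mat 1"
  shows "anti_automorphism (\<lambda>X. transpose J ** transpose X ** J)"
proof -
  have J: "J ** transpose J = mat 1"
    using assms by (simp add: matrix_left_right_inverse)
  have tt: "J ** (transpose J ** X) = X" "transpose J ** (J ** X) = X" for X :: "real^'n^'n"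
    using assms J by (simp_all add: matrix_mul_assoc)
  have lin: "linear (\<lambda>X. transpose J ** transpose X ** J)"
    by (rule linearI)
      (simp_all add: matrix_add_ldistrib matrix_add_rdistrib transpose_def vec_eq_iff
        matrix_matrix_mult_def sum.distrib sum_distrib_left algebra_simps)
  have inv: "transpose J ** transpose (J ** transpose X ** transpose J) ** J = X"
    "J ** transpose (transpose J ** transpose X ** J) ** transpose J = X" for X
    using assms J
    by (simp_all add: matrix_transpose_mul matrix_mul_assoc[symmetric] tt)
  have "bij (\<lambda>X. transpose J ** transpose X ** J)"
    by (rule o_bij[of "\<lambda>X. J ** transpose X ** transpose J"]) (auto simp: inv)
  then show ?thesis
    unfolding anti_automorphism_def using lin assms
    by (simp add: matrix_transpose_mul matrix_mul_assoc[symmetric] tt)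
qed

section \<open>Kronecker products\<close>

lemma sum_UNIV_prod:
  "(\<Sum>p\<in>UNIV. f p) = (\<Sum>a\<in>UNIV. \<Sum>b\<in>UNIV. f (a, b))"
  by (simp add: sum.cartesian_product)

lemma kron_mult:
  fixes A C :: "'a::comm_ring_1^'m^'m" and B D :: "'a^'n^'n"
  shows "(A \<otimes>\<^sub>K B) ** (C \<otimes>\<^sub>K D) = (A ** C) \<otimes>\<^sub>K (B ** D)"
  by (simp add: kron_def matrix_matrix_mult_def vec_eq_iff sum_product sum_UNIV_prod
      mult.assoc mult.left_commute)

lemma transpose_kron: "transpose (A \<otimes>\<^sub>K B) = transpose A \<otimes>\<^sub>K transpose B"
  by (simp add: kron_def transpose_def vec_eq_iff)

lemma kron_minus_left: "(- A) \<otimes>\<^sub>K B = - (A \<otimes>\<^sub>K (B :: 'a::ring_1^'n^'n))"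
  by (simp add: kron_def vec_eq_iff)

lemma kron_minus_right: "A \<otimes>\<^sub>K (- B) = - (A \<otimes>\<^sub>K (B :: 'a::ring_1^'n^'n))"
  by (simp add: kron_def vec_eq_iff)

lemma kron_mat_1: "mat 1 \<otimes>\<^sub>K mat 1 = (mat 1 :: 'a::ring_1^('m::finite \<times> 'n::finite)^('m \<times> 'n))"
  by (auto simp: kron_def vec_eq_iff mat_def prod_eq_iff)

lemma transpose_minus: "transpose (- A) = - transpose (A :: 'a::ring_1^'n^'m)"
  by (simp add: transpose_def vec_eq_iff)

section \<open>Kronecker factors of the six generators and of \<open>J8_tilde\<close>\<close>

lemma i_sigma_y_eq_J2: "i_sigma_y = J2"
  by (simp add: i_sigma_y_def J2_def sigma_y_def vec_eq_iff forall_2)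

text \<open>Oriented as rewrite rules towards the order \<open>sigma_x\<close>,
  \<open>sigma_z\<close>, \<open>J2\<close>, which is enough to compare products factor by
  factor.\<close>

lemma sigma_products:
  "sigma_x ** sigma_x = (mat 1 :: real^2^2)"
  "sigma_z ** sigma_z = (mat 1 :: real^2^2)"
  "J2 ** J2 = - mat 1"
  "sigma_z ** sigma_x = - (sigma_x ** sigma_z :: real^2^2)"
  "J2 ** sigma_x = - (sigma_x ** J2)"
  "J2 ** sigma_z = - (sigma_z ** J2)"
  by (simp_all add: sigma_x_def sigma_z_def J2_def matrix_matrix_mult_def vec_eq_iff forall_2
      sum_2 mat_def)

text \<open>Covers left-nested triple products, in which \<open>J2 ** J2\<close> is not visible as a
  subterm.\<close>

lemma sigma_J2_J2:
  "sigma_x ** J2 ** J2 = - sigma_x"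
  "sigma_z ** J2 ** J2 = - sigma_z"
  by (simp_all add: matrix_mul_assoc[symmetric] sigma_products matrix_mult_minus_right)

lemma transpose_sigma:
  "transpose sigma_x = (sigma_x :: real^2^2)"
  "transpose sigma_z = (sigma_z :: real^2^2)"
  "transpose J2 = - J2"
  by (simp_all add: sigma_x_def sigma_z_def J2_def transpose_def vec_eq_iff forall_2)

lemma J8_tilde_eq_kron: "J8_tilde = mat 1 \<otimes>\<^sub>K J2"
  by (auto simp: J8_tilde_def direct_sum_def kron_def vec_eq_iff mat_def)

lemmas kron_simps = kron_mult transpose_kron kron_minus_left kron_minus_right kron_mat_1
  matrix_mult_minus_left matrix_mult_minus_right transpose_minus sigma_products transpose_sigma

lemmas Y_defs = Y1_def Y2_def Y3_def Y4_def Y5_def Y6_def i_sigma_y_eq_J2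

lemma all_less_6: "(\<forall>i<6. P i) \<longleftrightarrow> P 0 \<and> P 1 \<and> P 2 \<and> P 3 \<and> P 4 \<and> P (5 :: nat)"
  by (simp add: numeral_eq_Suc All_less_Suc2)

text \<open>Up to sign, each generator has exactly one factor \<open>J2\<close> and its other
  factors square to the identity, so its square is -1. Two different generators anticommute because
  an odd number of their corresponding factors do.\<close>

lemma Y_basis_relations: "clifford_relations 0 6 Y_basis"
  unfolding clifford_relations_def gen_square_def add_0_left all_less_6
  by (simp add: Y_basis_def Y_defs kron_simps)

text \<open>Exactly one of the three factors is skew, namely \<open>J2\<close>; the others are
  symmetric.\<close>

lemma transpose_Y_basis: "X \<in> set Y_basis \<Longrightarrow> transpose X = - X"
  by (auto simp: Y_basis_def Y_defs kron_simps)

text \<open>The last factor is \<open>sigma_x\<close> or \<open>sigma_z\<close> up to sign and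
  anticommutes with \<open>J2\<close>, so conjugation by \<open>J8_tilde\<close> negates each
  generator. This sign cancels the one from transposition.\<close>

lemma twisted_transpose_Y_basis:
  "X \<in> set Y_basis \<Longrightarrow> transpose J8_tilde ** transpose X ** J8_tilde = X"
  by (auto simp: Y_basis_def Y_defs J8_tilde_eq_kron kron_simps sigma_J2_J2)

lemma J8_tilde_orthogonal: "transpose J8_tilde ** J8_tilde = mat 1"
  by (simp add: J8_tilde_eq_kron kron_simps)

section \<open>Even elements and the image of \<open>theta_C\<close>\<close>

lemma direct_sum_conjugate_nth:
  fixes J :: "'a::comm_ring_1^'n^'n" and X :: "'a^('m::finite \<times> 'n)^('m \<times> 'n)"
  shows "(transpose (direct_sum (\<lambda>_. J)) ** X ** direct_sum (\<lambda>_. J)) $ (a, k) $ (b, l) =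
    (\<Sum>m\<in>UNIV. (\<Sum>r\<in>UNIV. J $ r $ k * X $ (a, r) $ (b, m)) * J $ m $ l)"
  by (simp add: direct_sum_def matrix_matrix_mult_def transpose_def sum_UNIV_prod if_distrib
      if_distribR sum.swap[of _ "UNIV :: 'n set" "UNIV :: 'm set"] cong: if_cong)

text \<open>Each 2x2 block is conjugated separately by \<open>J2\<close>, which sends [[p, q],
  [r, s]] to [[s, -r], [-q, p]]. The fixed blocks are those of the shape
  \<open>theta_block\<close>.\<close>

lemma J8_tilde_conjugate_fixed_iff:
  "transpose J8_tilde ** X ** J8_tilde = X \<longleftrightarrow>
    (\<forall>a b. X $ (a, 2) $ (b, 2) = X $ (a, 1) $ (b, 1) \<and> X $ (a, 2) $ (b, 1) = - X $ (a, 1) $ (b, 2))"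
proof -
  let ?Z = "transpose J8_tilde ** X ** J8_tilde"
  have nth: "?Z $ (a, 1) $ (b, 1) = X $ (a, 2) $ (b, 2)" "?Z $ (a, 1) $ (b, 2) = - X $ (a, 2) $ (b, 1)"
    "?Z $ (a, 2) $ (b, 1) = - X $ (a, 1) $ (b, 2)" "?Z $ (a, 2) $ (b, 2) = X $ (a, 1) $ (b, 1)"
    for a b
    by (simp_all only: J8_tilde_def direct_sum_conjugate_nth) (simp_all add: J2_def sum_2)
  have "?Z = X \<longleftrightarrow> (\<forall>a k b l. ?Z $ (a, k) $ (b, l) = X $ (a, k) $ (b, l))"
    unfolding vec_eq_iff by (metis surj_pair)
  also have "\<dots> \<longleftrightarrow> (\<forall>a b. X $ (a, 2) $ (b, 2) = X $ (a, 1) $ (b, 1) \<and>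
      X $ (a, 2) $ (b, 1) = - X $ (a, 1) $ (b, 2))"
    unfolding forall_2 nth by (metis minus_minus)
  finally show ?thesis .
qed

lemma range_theta_C:
  "X \<in> range (theta_C :: cmat4 \<Rightarrow> mat8) \<longleftrightarrow>
    (\<forall>a b. X $ (a, 2) $ (b, 2) = X $ (a, 1) $ (b, 1) \<and> X $ (a, 2) $ (b, 1) = - X $ (a, 1) $ (b, 2))"
    (is "_ \<longleftrightarrow> ?fixed")
proof
  assume ?fixed
  \<comment> \<open>The first row of each block holds the real and imaginary parts of the preimage
    entry.\<close>
  then have "X = theta_C (\<chi> a b. Complex (X $ (a, 1) $ (b, 1)) (X $ (a, 1) $ (b, 2)))"
    by (auto simp: theta_C_def theta_block_def vec_eq_iff forall_2)
  then show "X \<in> range (theta_C :: cmat4 \<Rightarrow> mat8)"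
    by (rule range_eqI)
qed (auto simp: theta_C_def theta_block_def)

theorem proposition5p2:
  shows "is_one_vector_basis 0 6 Y_basis \<and>
    (\<forall>X. reversion Y_basis X = transpose J8_tilde ** transpose X ** J8_tilde) \<and>
    (\<forall>X. grade_involution Y_basis X = transpose J8_tilde ** X ** J8_tilde) \<and>
    even_vectors Y_basis = range (theta_C :: cmat4 \<Rightarrow> mat8)"
proof -
  have basis: "is_one_vector_basis 0 6 Y_basis"
    \<comment> \<open>The count is 8^2 = 2^6, with 6 even.\<close>
    by (rule is_one_vector_basis_if_relations[OF Y_basis_relations]) simp_all
  have rev: "reversion Y_basis = (\<lambda>X. transpose J8_tilde ** transpose X ** J8_tilde)"
    by (intro reversion_eqI[OF basis] anti_automorphism_twisted_transpose J8_tilde_orthogonal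
        twisted_transpose_Y_basis)
  have "anti_automorphism (transpose :: mat8 \<Rightarrow> mat8)"
    using anti_automorphism_twisted_transpose[of "mat 1 :: mat8"] by simp
  then have "clifford_conjugation Y_basis = transpose"
    by (rule clifford_conjugation_eqI[OF basis]) (rule transpose_Y_basis)
  \<comment> \<open>Composing reversion with transposition cancels the two transposes and leaves
    conjugation by \<open>J8_tilde\<close>.\<close>
  then have grade: "grade_involution Y_basis = (\<lambda>X. transpose J8_tilde ** X ** J8_tilde)"
    by (simp add: grade_involution_def rev fun_eq_iff)
  have "even_vectors Y_basis = range (theta_C :: cmat4 \<Rightarrow> mat8)"
    by (intro set_eqI)
      (simp only: even_vectors_def grade mem_Collect_eq J8_tilde_conjugate_fixed_iff range_theta_C)
  with basis rev grade show ?thesis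
    by simp
qed

end
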